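(* Let $f:\mathbb{R}^n\to\mathbb{R}$ be $\rho$-weakly convex and let $g:\mathbb{R}^n\to\mathbb{R}$ be $\tau$-strongly convex. Then for all $x_1,\dots,x_m\in\mathbb{R}^n$ and all $a_1,\dots,a_m\ge 0$ with $\sum_{i=1}^m a_i=1$, $$f\Big(\sum_{i=1}^m a_i x_i\Big)\le \sum_{i=1}^m a_i f(x_i)+\frac{\rho}{2}\sum_{i=1}^{m-1}\sum_{j=i+1}^m a_i a_j\|x_i-x_j\|^2$$ and $$g\Big(\sum_{i=1}^m a_i x_i\Big)\le \sum_{i=1}^m a_i g(x_i)-\frac{\tau}{2}\sum_{i=1}^{m-1}\sum_{j=i+1}^m a_i a_j\|x_i-x_j\|^2 .$$
   Context: $\|\cdot\|$ is the Euclidean norm. A function $f$ is $\rho$-weakly convex ($\rho>0$) if there exists a convex function $h$ such that $f(x)=h(x)-\frac{\rho}{2}\|x\|^2$. A function $g$ is $\tau$-strongly convex ($\tau>0$) if $g(x)-\frac{\tau}{2}\|x\|^2$ is convex. *)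

theory Defs
  imports "HOL-Analysis.Analysis"
begin

definition weakly_convex :: "real \<Rightarrow> ('a::euclidean_space \<Rightarrow> real) \<Rightarrow> bool" where
  "weakly_convex \<rho> f \<longleftrightarrow>
     \<rho> > 0 \<and> (\<exists>h. convex_on UNIV h \<and> (\<forall>x. f x = h x - \<rho> / 2 * (norm x)\<^sup>2))"

definition strongly_convex :: "real \<Rightarrow> ('a::euclidean_space \<Rightarrow> real) \<Rightarrow> bool" where
  "strongly_convex \<tau> g \<longleftrightarrow>
     \<tau> > 0 \<and> convex_on UNIV (\<lambda>x. g x - \<tau> / 2 * (norm x)\<^sup>2)"

end

theory Submission
  imports Defs
begin

text \<open>
  Both inequalities are Jensen's inequality for a convex function \<open>h\<close> plus a multiple of the
  squared norm. The point is that the Jensen gap of the squared norm is known exactly: for weights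
  summing to 1,
  \<open>(\<Sum>i. a i * (norm (x i))\<^sup>2) - (norm (\<Sum>i. a i *\<^sub>R x i))\<^sup>2\<close> equals
  \<open>\<Sum>i<j. a i * a j * (norm (x i - x j))\<^sup>2\<close> (the variance of a random point that equals \<open>x i\<close>
  with probability \<open>a i\<close>, written through pairwise distances; lemma
  \<open>sum_weighted_sq_dist\<close>). Adding \<open>c / 2\<close> times this identity to Jensen's inequality for \<open>h\<close>
  gives the result for \<open>h + c / 2 * (norm _)\<^sup>2\<close>, whatever the sign of \<open>c\<close> (lemma
  \<open>jensen_convex_plus_sq_norm\<close>); the two claims are the cases \<open>c = - \<rho>\<close> and \<open>c = \<tau>\<close>.
\<close>

text \<open>
  Lagrange's identity for weighted points. The weights are not assumed to sum to 1; this
  homogeneous form is what allows induction on the number of points.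
\<close>
lemma sum_weighted_sq_dist:
  fixes x :: "nat \<Rightarrow> 'a::real_inner" and a :: "nat \<Rightarrow> real"
  shows "(\<Sum>i=1..m-1. \<Sum>j=i+1..m. a i * a j * (norm (x i - x j))\<^sup>2)
       = (\<Sum>i=1..m. a i) * (\<Sum>i=1..m. a i * (norm (x i))\<^sup>2) - (norm (\<Sum>i=1..m. a i *\<^sub>R x i))\<^sup>2"
proof (induction m)
  case 0
  show ?case by simp
next
  case (Suc m)
  let ?d = "\<lambda>i j. a i * a j * (norm (x i - x j))\<^sup>2"
  let ?A = "\<Sum>i=1..m. a i" and ?Q = "\<Sum>i=1..m. a i * (norm (x i))\<^sup>2"
    and ?v = "\<Sum>i=1..m. a i *\<^sub>R x i"
  let ?b = "a (Suc m)" and ?y = "x (Suc m)"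
  \<comment> \<open>The inner sum is empty for \<open>i = m\<close>, so the outer sum may run up to \<open>m\<close>.\<close>
  have *: "(\<Sum>i=1..m. \<Sum>j=i+1..m. ?d i j) = (\<Sum>i=1..m-1. \<Sum>j=i+1..m. ?d i j)"
    by (cases m) simp_all
  have "(\<Sum>i=1..m. ?d i (Suc m))
      = (\<Sum>i=1..m. ?b * (a i * (norm (x i))\<^sup>2) + (?b * (norm ?y)\<^sup>2) * a i
          - (2 * ?b) * ((a i *\<^sub>R x i) \<bullet> ?y))"
    by (intro sum.cong refl)
       (simp add: power2_norm_eq_inner inner_diff_left inner_diff_right inner_commute algebra_simps)
  also have "\<dots> = ?b * ?Q + ?b * (norm ?y)\<^sup>2 * ?A - 2 * ?b * (?v \<bullet> ?y)"
    by (simp only: sum.distrib sum_subtractf flip: sum_distrib_left inner_sum_left)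
  finally have new: "(\<Sum>i=1..m. ?d i (Suc m)) = \<dots>" .
  have "(\<Sum>i=1..Suc m - 1. \<Sum>j=i+1..Suc m. ?d i j)
      = (\<Sum>i=1..m. (\<Sum>j=i+1..m. ?d i j) + ?d i (Suc m))"
    by (intro sum.cong) auto
  also have "\<dots> = ?A * ?Q - (norm ?v)\<^sup>2 + (?b * ?Q + ?b * (norm ?y)\<^sup>2 * ?A - 2 * ?b * (?v \<bullet> ?y))"
    by (simp only: sum.distrib * Suc.IH new)
  also have "\<dots> = (?A + ?b) * (?Q + ?b * (norm ?y)\<^sup>2) - (norm (?v + ?b *\<^sub>R ?y))\<^sup>2"
    unfolding power2_norm_eq_inner
    by (simp add: inner_add_left inner_add_right inner_commute algebra_simps)
  finally show ?case by simp
qed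

lemma jensen_convex_plus_sq_norm:
  fixes h :: "'a::real_inner \<Rightarrow> real" and x :: "nat \<Rightarrow> 'a" and a :: "nat \<Rightarrow> real"
  assumes h: "convex_on UNIV h"
    and f: "\<And>y. f y = h y + c / 2 * (norm y)\<^sup>2"
    and nonneg: "\<And>i. i \<in> {1..m} \<Longrightarrow> a i \<ge> 0"
    and sum1: "(\<Sum>i=1..m. a i) = 1"
  shows "f (\<Sum>i=1..m. a i *\<^sub>R x i) \<le> (\<Sum>i=1..m. a i * f (x i))
           - c / 2 * (\<Sum>i=1..m-1. \<Sum>j=i+1..m. a i * a j * (norm (x i - x j))\<^sup>2)"
proof -
  have "{1..m} \<noteq> {}" using sum1 by force
  then have "h (\<Sum>i=1..m. a i *\<^sub>R x i) \<le> (\<Sum>i=1..m. a i * h (x i))"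
    using convex_on_sum[OF _ _ h sum1 nonneg] by simp
  moreover have "(\<Sum>i=1..m. a i * f (x i))
      = (\<Sum>i=1..m. a i * h (x i)) + c / 2 * (\<Sum>i=1..m. a i * (norm (x i))\<^sup>2)"
    by (simp add: f distrib_left sum.distrib sum_distrib_left algebra_simps)
  ultimately show ?thesis
    unfolding sum_weighted_sq_dist sum1 f by (simp add: algebra_simps)
qed

theorem mainTheorem1:
  fixes f g :: "real ^ 'n \<Rightarrow> real"
    and \<rho> \<tau> :: real
    and m :: nat
    and x :: "nat \<Rightarrow> real ^ 'n"
    and a :: "nat \<Rightarrow> real"
  assumes "weakly_convex \<rho> f"
    and "strongly_convex \<tau> g"
    and "\<And>i. i \<in> {1..m} \<Longrightarrow> a i \<ge> 0"
    and "(\<Sum>i=1..m. a i) = 1"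
  shows "f (\<Sum>i=1..m. a i *\<^sub>R x i) \<le>
           (\<Sum>i=1..m. a i * f (x i))
           + \<rho> / 2 * (\<Sum>i=1..m-1. \<Sum>j=i+1..m. a i * a j * (norm (x i - x j))\<^sup>2)
       \<and> g (\<Sum>i=1..m. a i *\<^sub>R x i) \<le>
           (\<Sum>i=1..m. a i * g (x i))
           - \<tau> / 2 * (\<Sum>i=1..m-1. \<Sum>j=i+1..m. a i * a j * (norm (x i - x j))\<^sup>2)"
proof -
  obtain h where "convex_on UNIV h" and "\<And>y. f y = h y + (- \<rho>) / 2 * (norm y)\<^sup>2"
    using assms(1) unfolding weakly_convex_def by auto
  from jensen_convex_plus_sq_norm[OF this assms(3,4)]
  have "f (\<Sum>i=1..m. a i *\<^sub>R x i) \<le> (\<Sum>i=1..m. a i * f (x i))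
      + \<rho> / 2 * (\<Sum>i=1..m-1. \<Sum>j=i+1..m. a i * a j * (norm (x i - x j))\<^sup>2)"
    by simp
  moreover have "convex_on UNIV (\<lambda>y. g y - \<tau> / 2 * (norm y)\<^sup>2)"
    using assms(2) unfolding strongly_convex_def by simp
  then have "g (\<Sum>i=1..m. a i *\<^sub>R x i) \<le> (\<Sum>i=1..m. a i * g (x i))
      - \<tau> / 2 * (\<Sum>i=1..m-1. \<Sum>j=i+1..m. a i * a j * (norm (x i - x j))\<^sup>2)"
    by (rule jensen_convex_plus_sq_norm) (use assms(3,4) in auto)
  ultimately show ?thesis ..
qed

end
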